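(* Let $n\ge 2$, let $L=\partial^n+u_2\partial^{n-2}+\cdots+u_{n-1}\partial+u_n$ be the formal differential operator of order $n$ in $\mathcal{R}[\partial]$, let $m\ge 2$, and let $E_{m,k}(U,Y_m)$ denote the coefficient of $\partial^k$ in $[L,\tilde P_m]$, where $\tilde P_m=\partial^m+y_2\partial^{m-2}+\cdots+y_{m-1}\partial+y_m$. Then for every $i=3,\ldots,m+1$, $$E_{m,m+n-i}=n\,y_{i-1}'+e_{m,i-2},$$ where $e_{m,i-2}\in\mathcal{R}\{Y_{i-2}\}$ is homogeneous of weight $i$ (with $Y_1=\emptyset$). More precisely, $E_{m,m+n-3}=n y_2'-m u_2'$.
   Context: $\mathbf{C}$ is a field of characteristic zero with the zero derivation. $U=\{u_2,\ldots,u_n\}$ and $Y_m=\{y_2,\ldots,y_m\}$ are sets of independent differential variables; $Y_j=\{y_2,\ldots,y_j\}$ and $Y_1=\emptyset$. $\mathcal{R}=\mathbf{C}\{U\}$ is the ring of differential polynomials, i.e. the polynomial ring over $\mathbf{C}$ in the variables $u_\ell^{(k)}$ ($2\le\ell\le n$, $k\ge 0$), with derivation $\partial$ vanishing on $\mathbf{C}$ and $\partial(u_\ell^{(k)})=u_\ell^{(k+1)}$; similarly $\mathcal{R}\{Y_j\}$ is the polynomial ring over $\mathcal{R}$ in the variables $y_\ell^{(k)}$ ($2\le \ell\le j$, $k\ge0$), with $\partial(y_\ell^{(k)})=y_\ell^{(k+1)}$. For a differential ring $S$, $S[\partial]$ is the ring of differential operators with $\partial s=s\partial+\partial(s)$,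 and $[A,B]=AB-BA$. The weight on $\mathcal{R}\{Y_m\}$ is the grading determined by $w(u_\ell^{(k)})=w(y_\ell^{(k)})=\ell+k$ (elements of $\mathbf{C}$ have weight $0$, and the zero polynomial is regarded as homogeneous of every weight). *)

theory Defs
  imports Complex_Main "HOL-Library.Poly_Mapping" "HOL-Computational_Algebra.Polynomial"
begin

section \<open>Differential polynomials\<close>

text \<open>
  \<open>UVar l k\<close> stands for the derivative \<open>u\<^sub>l\<^sup>(\<^sup>k\<^sup>)\<close>, and \<open>YVar l k\<close> for \<open>y\<^sub>l\<^sup>(\<^sup>k\<^sup>)\<close>. The type \<open>'a dpoly\<close> is
  the polynomial ring over the constants \<open>'a\<close> in all of these, for arbitrary indices \<open>l\<close>; the rings
  with restricted index sets are the differential subrings \<open>ring_RY n j\<close> below.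
\<close>

datatype dvar = UVar nat nat | YVar nat nat

type_synonym 'a dpoly = "(dvar \<Rightarrow>\<^sub>0 nat) \<Rightarrow>\<^sub>0 'a"

definition Const :: "'a::comm_ring_1 \<Rightarrow> 'a dpoly" where
  "Const c = Poly_Mapping.single 0 c"

definition Var :: "dvar \<Rightarrow> 'a::comm_ring_1 dpoly" where
  "Var v = Poly_Mapping.single (Poly_Mapping.single v 1) 1"

abbreviation uvar :: "nat \<Rightarrow> 'a::comm_ring_1 dpoly" where
  "uvar l \<equiv> Var (UVar l 0)"

abbreviation yvar :: "nat \<Rightarrow> 'a::comm_ring_1 dpoly" where
  "yvar l \<equiv> Var (YVar l 0)"

fun next_var :: "dvar \<Rightarrow> dvar" where
  "next_var (UVar l k) = UVar l (Suc k)"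
| "next_var (YVar l k) = YVar l (Suc k)"

text \<open>
  The derivation, as the sum of \<open>\<partial>p / \<partial>v\<close> times \<open>v'\<close> over the variables \<open>v\<close>. The lemmas after the
  definition characterise it: it is additive, satisfies the Leibniz rule, vanishes on the
  constants and raises the order of each variable by one.
\<close>

definition deriv_monom :: "(dvar \<Rightarrow>\<^sub>0 nat) \<Rightarrow> 'a::comm_ring_1 \<Rightarrow> 'a dpoly" where
  "deriv_monom t c =
     (\<Sum>v\<in>Poly_Mapping.keys t.
        Poly_Mapping.single (t - Poly_Mapping.single v 1)
          (of_nat (Poly_Mapping.lookup t v) * c) * Var (next_var v))"

definition dd :: "'a::comm_ring_1 dpoly \<Rightarrow> 'a dpoly" where
  "dd p = (\<Sum>t\<in>Poly_Mapping.keys p. deriv_monom t (Poly_Mapping.lookup p t))"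

lemma deriv_monom_superset:
  assumes "finite S" "Poly_Mapping.keys t \<subseteq> S"
  shows "deriv_monom t c =
     (\<Sum>v\<in>S. Poly_Mapping.single (t - Poly_Mapping.single v 1)
          (of_nat (Poly_Mapping.lookup t v) * c) * Var (next_var v))"
  unfolding deriv_monom_def
  by (rule sum.mono_neutral_left) (use assms in \<open>auto simp: in_keys_iff\<close>)

lemma deriv_monom_zero [simp]: "deriv_monom t 0 = 0"
  by (simp add: deriv_monom_def)

lemma deriv_monom_add: "deriv_monom t (a + b) = deriv_monom t a + deriv_monom t b"
  by (simp add: deriv_monom_def algebra_simps single_add sum.distrib)

lemma dd_superset:
  assumes "finite S" "Poly_Mapping.keys p \<subseteq> S"
  shows "dd p = (\<Sum>t\<in>S. deriv_monom t (Poly_Mapping.lookup p t))"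
  unfolding dd_def
  by (rule sum.mono_neutral_left) (use assms in \<open>auto simp: in_keys_iff\<close>)

lemma dd_single [simp]: "dd (Poly_Mapping.single t c) = deriv_monom t c"
  by (subst dd_superset[of "{t}"]) auto

lemma dd_0 [simp]: "dd 0 = 0"
  by (simp add: dd_def)

lemma dd_add: "dd (p + q) = dd p + dd q"
proof -
  let ?S = "Poly_Mapping.keys p \<union> Poly_Mapping.keys q"
  have "dd (p + q) = (\<Sum>t\<in>?S. deriv_monom t (Poly_Mapping.lookup (p + q) t))"
    by (rule dd_superset) (simp_all add: Poly_Mapping.keys_add)
  also have "\<dots> = (\<Sum>t\<in>?S. deriv_monom t (Poly_Mapping.lookup p t))
                + (\<Sum>t\<in>?S. deriv_monom t (Poly_Mapping.lookup q t))"
    by (simp add: lookup_add deriv_monom_add sum.distrib)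
  also have "\<dots> = dd p + dd q"
    by (simp add: dd_superset[of ?S p] dd_superset[of ?S q])
  finally show ?thesis .
qed

lemma dd_sum: "dd (sum f A) = (\<Sum>x\<in>A. dd (f x))"
  by (induction A rule: infinite_finite_induct) (auto simp: dd_add)

lemma deriv_monom_mult:
  "deriv_monom (s + t) (a * b) =
     Poly_Mapping.single s a * deriv_monom t b + deriv_monom s a * Poly_Mapping.single t b"
proof -
  let ?S = "Poly_Mapping.keys s \<union> Poly_Mapping.keys t"
  have shift: "r + t - Poly_Mapping.single v 1 = r + (t - Poly_Mapping.single v 1)"
    if "Poly_Mapping.lookup t v \<noteq> 0" for r t :: "dvar \<Rightarrow>\<^sub>0 nat" and v
    by (rule poly_mapping_eqI)
       (use that in \<open>auto simp: lookup_add lookup_minus lookup_single when_def\<close>)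
  have shift': "s + t - Poly_Mapping.single v 1 = s - Poly_Mapping.single v 1 + t"
    if "Poly_Mapping.lookup s v \<noteq> 0" for v
    using shift[OF that, of t] by (simp only: add.commute)
  have summand: "Poly_Mapping.single (s + t - Poly_Mapping.single v 1)
            (of_nat (Poly_Mapping.lookup (s + t) v) * (a * b))
      = Poly_Mapping.single s a * Poly_Mapping.single (t - Poly_Mapping.single v 1)
            (of_nat (Poly_Mapping.lookup t v) * b)
      + Poly_Mapping.single (s - Poly_Mapping.single v 1)
            (of_nat (Poly_Mapping.lookup s v) * a) * Poly_Mapping.single t b" for v
  proof -
    have 1: "Poly_Mapping.single (s + t - Poly_Mapping.single v 1)
               (of_nat (Poly_Mapping.lookup t v) * (a * b))
      = Poly_Mapping.single s a * Poly_Mapping.single (t - Poly_Mapping.single v 1)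
            (of_nat (Poly_Mapping.lookup t v) * b)"
      by (cases "Poly_Mapping.lookup t v = 0")
         (simp_all add: mult_single shift algebra_simps del: One_nat_def)
    have 2: "Poly_Mapping.single (s + t - Poly_Mapping.single v 1)
               (of_nat (Poly_Mapping.lookup s v) * (a * b))
      = Poly_Mapping.single (s - Poly_Mapping.single v 1)
            (of_nat (Poly_Mapping.lookup s v) * a) * Poly_Mapping.single t b"
      by (cases "Poly_Mapping.lookup s v = 0")
         (simp_all add: mult_single shift' algebra_simps del: One_nat_def)
    show ?thesis
      by (simp only: lookup_add of_nat_add distrib_right single_add 1 2 add.commute)
  qed
  have "deriv_monom (s + t) (a * b) =
     (\<Sum>v\<in>?S. Poly_Mapping.single (s + t - Poly_Mapping.single v 1)
          (of_nat (Poly_Mapping.lookup (s + t) v) * (a * b)) * Var (next_var v))"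
    by (rule deriv_monom_superset) (simp_all add: Poly_Mapping.keys_add)
  also have "\<dots> = Poly_Mapping.single s a * deriv_monom t b
                + deriv_monom s a * Poly_Mapping.single t b"
    unfolding summand
    by (simp only: deriv_monom_superset[of ?S s] deriv_monom_superset[of ?S t]
          finite_Un finite_keys Un_upper1 Un_upper2 simp_thms
          sum_distrib_left sum_distrib_right distrib_right sum.distrib mult.assoc)
       (simp only: mult.commute mult.left_commute)
  finally show ?thesis .
qed

lemma dpoly_as_sum:
  "p = (\<Sum>t\<in>Poly_Mapping.keys p. Poly_Mapping.single t (Poly_Mapping.lookup p t))"
  by (rule poly_mapping_eqI)
     (auto simp: lookup_sum lookup_single when_def in_keys_iff sum.delta)

lemma dd_mult: "dd (p * q) = p * dd q + dd p * q"
proof -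
  let ?m = "\<lambda>r t. Poly_Mapping.single t (Poly_Mapping.lookup r t)"
  let ?P = "Poly_Mapping.keys p" and ?Q = "Poly_Mapping.keys q"
  have "p * q = (\<Sum>s\<in>?P. \<Sum>t\<in>?Q. ?m p s * ?m q t)"
    by (subst (1) dpoly_as_sum[of p], subst (1) dpoly_as_sum[of q]) (rule sum_product)
  hence "dd (p * q) = (\<Sum>s\<in>?P. \<Sum>t\<in>?Q. ?m p s * dd (?m q t) + dd (?m p s) * ?m q t)"
    by (simp add: dd_sum mult_single deriv_monom_mult)
  also have "\<dots> = (\<Sum>s\<in>?P. ?m p s) * (\<Sum>t\<in>?Q. dd (?m q t))
                + (\<Sum>s\<in>?P. dd (?m p s)) * (\<Sum>t\<in>?Q. ?m q t)"
    by (simp only: sum.distrib sum_product)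
  also have "\<dots> = p * dd q + dd p * q"
    by (simp only: dpoly_as_sum[symmetric] dd_sum[symmetric])
  finally show ?thesis .
qed

lemma dd_Const [simp]: "dd (Const c) = 0"
  by (simp add: Const_def deriv_monom_def)

lemma dd_Var [simp]: "dd (Var v) = Var (next_var v)"
  by (simp add: Var_def deriv_monom_def mult_single)

text \<open>
  \<open>ring_RY n j\<close> is \<open>\<R>{Y\<^sub>j}\<close> for \<open>\<R> = \<C>{u\<^sub>2, \<dots>, u\<^sub>n}\<close>, with \<open>\<R>{Y\<^sub>j}\<close> viewed as the polynomial ring over
  \<open>\<C>\<close> in the union of the two families of variables. In particular \<open>ring_RY n 1\<close> is \<open>\<R>\<close> itself.
\<close>

definition vars_RY :: "nat \<Rightarrow> nat \<Rightarrow> dvar set" where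
  "vars_RY n j = {UVar l k | l k. 2 \<le> l \<and> l \<le> n} \<union> {YVar l k | l k. 2 \<le> l \<and> l \<le> j}"

definition ring_RY :: "nat \<Rightarrow> nat \<Rightarrow> 'a::comm_ring_1 dpoly set" where
  "ring_RY n j = {p. \<forall>t\<in>Poly_Mapping.keys p. Poly_Mapping.keys t \<subseteq> vars_RY n j}"

lemma Const_in_ring_RY: "Const c \<in> ring_RY n j"
  by (simp add: ring_RY_def Const_def)

lemma Var_in_ring_RY: "v \<in> vars_RY n j \<Longrightarrow> Var v \<in> ring_RY n j"
  by (simp add: ring_RY_def Var_def)

lemma add_in_ring_RY: "p \<in> ring_RY n j \<Longrightarrow> q \<in> ring_RY n j \<Longrightarrow> p + q \<in> ring_RY n j"
  using Poly_Mapping.keys_add[of p q] by (fastforce simp: ring_RY_def)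

lemma mult_in_ring_RY:
  assumes "p \<in> ring_RY n j" "q \<in> ring_RY n j"
  shows "p * q \<in> ring_RY n j"
  unfolding ring_RY_def
proof (safe del: subsetI)
  fix t assume "t \<in> Poly_Mapping.keys (p * q)"
  then obtain a b where "t = a + b" "a \<in> Poly_Mapping.keys p" "b \<in> Poly_Mapping.keys q"
    using keys_mult[of p q] by blast
  thus "Poly_Mapping.keys t \<subseteq> vars_RY n j"
    using assms Poly_Mapping.keys_add[of a b] by (fastforce simp: ring_RY_def)
qed

lemma sum_in_ring_RY: "(\<And>x. x \<in> A \<Longrightarrow> f x \<in> ring_RY n j) \<Longrightarrow> sum f A \<in> ring_RY n j"
  by (induction A rule: infinite_finite_induct) (auto simp: add_in_ring_RY, auto simp: ring_RY_def)

lemma dd_in_ring_RY: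
  assumes "p \<in> ring_RY n j"
  shows "dd p \<in> ring_RY n j"
  unfolding dd_def deriv_monom_def
proof (intro sum_in_ring_RY mult_in_ring_RY Var_in_ring_RY)
  fix t v assume tv: "t \<in> Poly_Mapping.keys p" "v \<in> Poly_Mapping.keys t"
  hence sub: "Poly_Mapping.keys t \<subseteq> vars_RY n j"
    using assms by (auto simp: ring_RY_def)
  thus "next_var v \<in> vars_RY n j"
    using tv by (cases v) (auto simp: vars_RY_def)
  have "Poly_Mapping.keys (t - Poly_Mapping.single v 1) \<subseteq> Poly_Mapping.keys t"
    by (auto simp: in_keys_iff lookup_minus)
  thus "Poly_Mapping.single (t - Poly_Mapping.single v 1)
          (of_nat (Poly_Mapping.lookup t v) * Poly_Mapping.lookup p t) \<in> ring_RY n j"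
    using sub by (auto simp: ring_RY_def)
qed

fun var_weight :: "dvar \<Rightarrow> nat" where
  "var_weight (UVar l k) = l + k"
| "var_weight (YVar l k) = l + k"

definition monom_weight :: "(dvar \<Rightarrow>\<^sub>0 nat) \<Rightarrow> nat" where
  "monom_weight t = (\<Sum>v\<in>Poly_Mapping.keys t. Poly_Mapping.lookup t v * var_weight v)"

definition homogeneous :: "nat \<Rightarrow> 'a::comm_ring_1 dpoly \<Rightarrow> bool" where
  "homogeneous w p \<longleftrightarrow> (\<forall>t\<in>Poly_Mapping.keys p. monom_weight t = w)"

section \<open>Differential operators\<close>

text \<open>
  An element \<open>\<Sum>\<^sub>k a\<^sub>k \<partial>\<^sup>k\<close> of \<open>S[\<partial>]\<close> is represented by the polynomial with coefficients \<open>a\<^sub>k\<close>, written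
  to the left of the powers of \<open>\<partial>\<close>; only the additive structure of \<open>'s poly\<close> is that of \<open>S[\<partial>]\<close>.
  By \<open>\<partial> s = s \<partial> + \<partial>(s)\<close>, left multiplication by \<open>\<partial>\<close> sends \<open>\<Sum>\<^sub>k b\<^sub>k \<partial>\<^sup>k\<close> to
  \<open>\<Sum>\<^sub>k b\<^sub>k \<partial>\<^sup>k\<^sup>+\<^sup>1 + \<Sum>\<^sub>k \<partial>(b\<^sub>k) \<partial>\<^sup>k\<close>, and this determines the product.
\<close>

definition left_D :: "('s \<Rightarrow> 's) \<Rightarrow> 's::comm_ring_1 poly \<Rightarrow> 's poly" where
  "left_D d B = pCons 0 B + map_poly d B"

definition op_mult :: "('s \<Rightarrow> 's) \<Rightarrow> 's::comm_ring_1 poly \<Rightarrow> 's poly \<Rightarrow> 's poly" where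
  "op_mult d A B = (\<Sum>i\<le>degree A. smult (coeff A i) ((left_D d ^^ i) B))"

definition op_bracket :: "('s \<Rightarrow> 's) \<Rightarrow> 's::comm_ring_1 poly \<Rightarrow> 's poly \<Rightarrow> 's poly" where
  "op_bracket d A B = op_mult d A B - op_mult d B A"

text \<open>
  The ring laws of \<open>S[\<partial>]\<close>, for any derivation \<open>d\<close> of \<open>S\<close>; here \<open>[:s:]\<close> is the operator of order zero
  given by \<open>s\<close> and \<open>[:0, 1:]\<close> is \<open>\<partial>\<close>.
\<close>

locale derivation =
  fixes d :: "'s::comm_ring_1 \<Rightarrow> 's"
  assumes d_add: "d (a + b) = d a + d b"
    and d_mult: "d (a * b) = a * d b + d a * b"
begin

lemma d_0 [simp]: "d 0 = 0"
  using d_add[of 0 0] by simp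

lemma d_1 [simp]: "d 1 = 0"
  using d_mult[of 1 1] by simp

lemma coeff_left_D:
  "coeff (left_D d B) k = (case k of 0 \<Rightarrow> 0 | Suc j \<Rightarrow> coeff B j) + d (coeff B k)"
  by (simp add: left_D_def coeff_pCons coeff_map_poly)

lemma left_D_0 [simp]: "left_D d 0 = 0"
  by (simp add: left_D_def)

lemma left_D_add: "left_D d (A + B) = left_D d A + left_D d B"
  by (rule poly_eqI) (simp add: coeff_left_D d_add split: nat.split)

lemma left_D_smult: "left_D d (smult a B) = smult a (left_D d B) + smult (d a) B"
  by (rule poly_eqI) (simp add: coeff_left_D d_mult algebra_simps split: nat.split)

lemma left_D_sum: "left_D d (sum f A) = (\<Sum>x\<in>A. left_D d (f x))"
  by (induction A rule: infinite_finite_induct) (auto simp: left_D_add)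

lemma left_D_pow_0 [simp]: "(left_D d ^^ i) 0 = 0"
  by (induction i) auto

lemma left_D_pow_add: "(left_D d ^^ i) (A + B) = (left_D d ^^ i) A + (left_D d ^^ i) B"
  by (induction i) (auto simp: left_D_add)

lemma op_mult_bound:
  assumes "degree A \<le> N"
  shows "op_mult d A B = (\<Sum>i\<le>N. smult (coeff A i) ((left_D d ^^ i) B))"
  unfolding op_mult_def
  by (rule sum.mono_neutral_left) (use assms in \<open>auto simp: coeff_eq_0\<close>)

lemma op_mult_distrib_left: "op_mult d A (B + C) = op_mult d A B + op_mult d A C"
  by (simp add: op_mult_def left_D_pow_add smult_add_right sum.distrib)

lemma op_mult_distrib_right: "op_mult d (A + B) C = op_mult d A C + op_mult d B C"
proof -
  let ?N = "max (degree A) (degree B)"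
  show ?thesis
    by (simp add: op_mult_bound[of _ ?N] degree_add_le smult_add_left sum.distrib)
qed

lemma op_mult_0_left [simp]: "op_mult d 0 B = 0"
  by (simp add: op_mult_def)

lemma op_mult_sum_left: "op_mult d (sum f A) B = (\<Sum>x\<in>A. op_mult d (f x) B)"
  by (induction A rule: infinite_finite_induct) (auto simp: op_mult_distrib_right)

lemma smult_sum_right: "smult a (sum f A) = (\<Sum>x\<in>A. smult a (f x))" for f :: "_ \<Rightarrow> 's poly"
  by (induction A rule: infinite_finite_induct) (auto simp: smult_add_right)

lemma op_mult_smult_left: "op_mult d (smult a A) B = smult a (op_mult d A B)"
  by (subst op_mult_bound[of "smult a A" "degree A"])
     (simp_all add: op_mult_def degree_smult_le smult_sum_right)

lemma op_mult_const_left: "op_mult d [:a:] B = smult a B"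
  by (simp add: op_mult_def)

lemma op_mult_D_left: "op_mult d [:0, 1:] B = left_D d B"
  by (simp add: op_mult_def)

lemma op_mult_1_right: "op_mult d A 1 = A"
proof -
  have "(left_D d ^^ i) 1 = monom 1 i" for i
    by (induction i)
       (auto intro!: poly_eqI simp: coeff_left_D if_distrib[of d] split: nat.split)
  thus ?thesis
    by (simp add: op_mult_def smult_monom poly_as_sum_of_monoms)
qed

lemma D_commutation: "op_mult d [:0, 1:] [:s:] = op_mult d [:s:] [:0, 1:] + [:d s:]"
  by (rule poly_eqI)
     (simp add: op_mult_D_left op_mult_const_left coeff_left_D coeff_pCons split: nat.split)

lemma op_mult_left_D: "op_mult d (left_D d A) B = left_D d (op_mult d A B)"
proof -
  let ?N = "degree A" and ?T = "\<lambda>i. (left_D d ^^ i) B"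
  have map: "op_mult d (map_poly d A) B = (\<Sum>i\<le>?N. smult (d (coeff A i)) (?T i))"
    by (subst op_mult_bound[of _ ?N]) (simp_all add: map_poly_degree_leq coeff_map_poly)
  have "op_mult d (pCons 0 A) B = (\<Sum>i\<le>Suc ?N. smult (coeff (pCons 0 A) i) (?T i))"
    by (rule op_mult_bound) (rule degree_pCons_le)
  also have "\<dots> = (\<Sum>i\<le>?N. smult (coeff A i) (?T (Suc i)))"
    by (subst sum.atMost_Suc_shift) simp
  finally show ?thesis
    using map by (simp add: left_D_def[of d A] op_mult_distrib_right)
      (simp add: op_mult_def left_D_sum left_D_smult sum.distrib)
qed

lemma op_mult_left_D_pow: "op_mult d ((left_D d ^^ i) A) B = (left_D d ^^ i) (op_mult d A B)"
  by (induction i) (auto simp: op_mult_left_D)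

lemma op_mult_assoc: "op_mult d (op_mult d A B) C = op_mult d A (op_mult d B C)"
proof -
  have "op_mult d (op_mult d A B) C
      = op_mult d (\<Sum>i\<le>degree A. smult (coeff A i) ((left_D d ^^ i) B)) C"
    by (simp only: op_mult_def[of d A B])
  also have "\<dots> = (\<Sum>i\<le>degree A. smult (coeff A i) ((left_D d ^^ i) (op_mult d B C)))"
    by (simp only: op_mult_sum_left op_mult_smult_left op_mult_left_D_pow)
  finally show ?thesis
    by (simp only: op_mult_def[of d A])
qed

end

lemma derivation_dd: "derivation (dd :: 'a::comm_ring_1 dpoly \<Rightarrow> 'a dpoly)"
  by unfold_locales (rule dd_add, rule dd_mult)

section \<open>The formal operators and the coefficients of their commutator\<close>

definition L_op :: "nat \<Rightarrow> 'a::comm_ring_1 dpoly poly" where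
  "L_op n = monom 1 n + (\<Sum>l=2..n. monom (uvar l) (n - l))"

definition P_op :: "nat \<Rightarrow> 'a::comm_ring_1 dpoly poly" where
  "P_op m = monom 1 m + (\<Sum>l=2..m. monom (yvar l) (m - l))"

definition E_coeff :: "nat \<Rightarrow> nat \<Rightarrow> nat \<Rightarrow> 'a::comm_ring_1 dpoly" where
  "E_coeff n m k = coeff (op_bracket dd (L_op n) (P_op m)) k"

end

(* Put a_0 = b_0 = 1, a_1 = b_1 = 0, a_l = u_l and b_l = y_l, so that L is the sum of the
   a_p D^(n-p) and P is the sum of the b_q D^(m-q). By the Leibniz rule
   D^k b = sum_r (k choose r) b^(r) D^(k-r), the coefficient of D^(m+n-i) in [L,P] is the sum of
   (n-p choose r) a_p b_q^(r) - (m-q choose r) b_q a_p^(r) over p + q + r = i. The terms with r = 0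
   cancel, so q <= i - 1, and q = i - 1 forces p = 0 and r = 1, which contributes n y_{i-1}'. All
   other terms have weight p + q + r = i and involve only the y_q with q <= i - 2. *)

theory Submission
  imports Defs
begin

section \<open>Leibniz rule and coefficients of products and commutators of operators\<close>

context derivation
begin

lemma d_of_nat_mult: "d (of_nat k * a) = of_nat k * d a"
  by (induction k) (simp_all add: d_add distrib_right)

lemma d_pow_0 [simp]: "(d ^^ r) 0 = 0"
  by (induction r) simp_all

lemma d_pow_1: "r > 0 \<Longrightarrow> (d ^^ r) 1 = 0"
  by (cases r) (simp_all add: funpow_Suc_right del: funpow.simps)

lemma left_D_monom: "left_D d (monom a k) = monom a (Suc k) + monom (d a) k"
  by (rule poly_eqI) (auto simp: coeff_left_D split: nat.split)

text \<open>The Leibniz rule for D^k b D^q, by induction on \<open>k\<close> with Pascal's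
  rule.\<close>

lemma left_D_pow_monom:
  "(left_D d ^^ k) (monom b q) =
     (\<Sum>r\<le>k. monom (of_nat (k choose r) * (d ^^ r) b) (q + k - r))"
proof (induction k)
  case 0
  show ?case by simp
next
  case (Suc k)
  let ?b = "\<lambda>r. (d ^^ r) b"
  have "(left_D d ^^ Suc k) (monom b q) =
      (\<Sum>r\<le>k. monom (of_nat (k choose r) * ?b r) (Suc (q + k - r)))
    + (\<Sum>r\<le>k. monom (of_nat (k choose r) * ?b (Suc r)) (q + k - r))"
    by (simp add: Suc left_D_sum left_D_monom d_of_nat_mult sum.distrib)
  \<comment> \<open>The extra summand r = k + 1 vanishes because \<open>k choose Suc k\<close> is
    0.\<close>
  also have "(\<Sum>r\<le>k. monom (of_nat (k choose r) * ?b r) (Suc (q + k - r)))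
      = (\<Sum>r\<le>Suc k. monom (of_nat (k choose r) * ?b r) (q + Suc k - r))"
    by (auto simp: Suc_diff_le binomial_eq_0 intro!: sum.cong)
  also have "\<dots> = monom b (q + Suc k)
      + (\<Sum>r\<le>k. monom (of_nat (k choose Suc r) * ?b (Suc r)) (q + k - r))"
    by (subst sum.atMost_Suc_shift) simp
  \<comment> \<open>Pascal's rule merges the two sums.\<close>
  also have "\<dots> + (\<Sum>r\<le>k. monom (of_nat (k choose r) * ?b (Suc r)) (q + k - r))
      = monom b (q + Suc k)
      + (\<Sum>r\<le>k. monom (of_nat (Suc k choose Suc r) * ?b (Suc r)) (q + k - r))"
    by (simp add: add_monom sum.distrib distrib_right add.assoc add.commute
        flip: sum.distrib)
  also have "\<dots> = (\<Sum>r\<le>Suc k. monom (of_nat (Suc k choose r) * ?b r) (q + Suc k - r))"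
    by (subst sum.atMost_Suc_shift) simp
  finally show ?case .
qed

lemma op_mult_sum_right: "op_mult d A (sum f S) = (\<Sum>x\<in>S. op_mult d A (f x))"
  by (induction S rule: infinite_finite_induct)
     (auto simp: op_mult_distrib_left, auto simp: op_mult_def)

lemma op_mult_monom_left: "op_mult d (monom a k) B = smult a ((left_D d ^^ k) B)"
proof -
  have "op_mult d (monom a k) B = (\<Sum>i\<le>k. smult (coeff (monom a k) i) ((left_D d ^^ i) B))"
    by (rule op_mult_bound) (rule degree_monom_le)
  also have "\<dots> = (\<Sum>i\<le>k. if k = i then smult a ((left_D d ^^ i) B) else 0)"
    by (intro sum.cong) auto
  finally show ?thesis by simp
qed

text \<open>In the Leibniz expansion of a D^(n-p) b D^(m-q), only r = i - p - q reaches D^(m+n-i).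
  If p + q > i, the product has too small an order; the explicit test keeps truncated subtraction
  from turning this case into r = 0.\<close>

lemma coeff_op_mult_monom:
  assumes "p \<le> n" "q \<le> m" "i \<le> m + n"
  shows "coeff (op_mult d (monom a (n - p)) (monom b (m - q))) (m + n - i) =
    (if p + q \<le> i then of_nat ((n - p) choose (i - p - q)) * a * (d ^^ (i - p - q)) b else 0)"
proof -
  have "coeff (op_mult d (monom a (n - p)) (monom b (m - q))) (m + n - i) =
      (\<Sum>r\<le>n - p. if m - q + (n - p) - r = m + n - i
                 then of_nat ((n - p) choose r) * a * (d ^^ r) b else 0)"
    by (simp add: op_mult_monom_left left_D_pow_monom coeff_sum sum_distrib_left mult_ac
        cong: if_cong) (auto intro!: sum.cong)
  also have "\<dots> = (\<Sum>r\<le>n - p. if r = i - p - q \<and> p + q \<le> i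
                 then of_nat ((n - p) choose r) * a * (d ^^ r) b else 0)"
    using assms by (intro sum.cong if_cong) auto
  \<comment> \<open>The index i - p - q may exceed n - p and so leave the range of summation; the
    binomial coefficient is then 0.\<close>
  also have "\<dots> = (if p + q \<le> i
      then of_nat ((n - p) choose (i - p - q)) * a * (d ^^ (i - p - q)) b else 0)"
    by (auto simp: not_le binomial_eq_0)
  finally show ?thesis .
qed

lemma coeff_op_bracket_sum_monom:
  assumes "i \<le> m + n"
  shows "coeff (op_bracket d (\<Sum>p\<le>n. monom (a p) (n - p)) (\<Sum>q\<le>m. monom (b q) (m - q))) (m + n - i) =
    (\<Sum>q\<le>m. \<Sum>p\<le>n. if p + q < i
       then of_nat ((n - p) choose (i - p - q)) * a p * (d ^^ (i - p - q)) (b q)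
          - of_nat ((m - q) choose (i - p - q)) * b q * (d ^^ (i - p - q)) (a p)
       else 0)"
proof -
  let ?A = "\<lambda>p. monom (a p) (n - p)" and ?B = "\<lambda>q. monom (b q) (m - q)"
  have "coeff (op_bracket d (sum ?A {..n}) (sum ?B {..m})) (m + n - i) =
      (\<Sum>q\<le>m. \<Sum>p\<le>n. coeff (op_mult d (?A p) (?B q)) (m + n - i))
    - (\<Sum>q\<le>m. \<Sum>p\<le>n. coeff (op_mult d (?B q) (?A p)) (m + n - i))"
    unfolding op_bracket_def
    by (simp add: op_mult_sum_left op_mult_sum_right coeff_sum)
       (rule sum.swap)
  also have "\<dots> = (\<Sum>q\<le>m. \<Sum>p\<le>n. coeff (op_mult d (?A p) (?B q)) (m + n - i)
                      - coeff (op_mult d (?B q) (?A p)) (m + n - i))"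
    by (simp add: sum_subtractf)
  also have "\<dots> = (\<Sum>q\<le>m. \<Sum>p\<le>n. if p + q < i
       then of_nat ((n - p) choose (i - p - q)) * a p * (d ^^ (i - p - q)) (b q)
          - of_nat ((m - q) choose (i - p - q)) * b q * (d ^^ (i - p - q)) (a p)
       else 0)"
  proof (intro sum.cong refl)
    fix p q assume "q \<in> {..m}" "p \<in> {..n}"
    then have "p \<le> n" "q \<le> m" by auto
    then show "coeff (op_mult d (?A p) (?B q)) (m + n - i)
             - coeff (op_mult d (?B q) (?A p)) (m + n - i) =
      (if p + q < i
       then of_nat ((n - p) choose (i - p - q)) * a p * (d ^^ (i - p - q)) (b q)
          - of_nat ((m - q) choose (i - p - q)) * b q * (d ^^ (i - p - q)) (a p)
       else 0)"
      \<comment> \<open>For p + q = i both products contribute r = 0, and a_p b_q - b_q a_p = 0 by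
        commutativity of the coefficients; hence the strict inequality.\<close>
      using coeff_op_mult_monom[of p n q m i "a p" "b q"]
        coeff_op_mult_monom[of q m p n i "b q" "a p"] assms
      by (cases "p + q = i") (auto simp: add.commute diff_commute)
  qed
  finally show ?thesis .
qed

end

section \<open>The weight grading\<close>

lemma monom_weight_superset:
  assumes "finite S" "Poly_Mapping.keys t \<subseteq> S"
  shows "monom_weight t = (\<Sum>v\<in>S. Poly_Mapping.lookup t v * var_weight v)"
  unfolding monom_weight_def
  by (rule sum.mono_neutral_left) (use assms in \<open>auto simp: in_keys_iff\<close>)

lemma monom_weight_add: "monom_weight (s + t) = monom_weight s + monom_weight t"
proof -
  let ?S = "Poly_Mapping.keys s \<union> Poly_Mapping.keys t"
  show ?thesis
    using Poly_Mapping.keys_add[of s t]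
    by (simp add: monom_weight_superset[of ?S] lookup_add distrib_right sum.distrib)
qed

lemma monom_weight_single [simp]: "monom_weight (Poly_Mapping.single v k) = k * var_weight v"
  by (simp add: monom_weight_def)

lemma homogeneous_0 [simp]: "homogeneous w 0"
  by (simp add: homogeneous_def)

lemma homogeneous_1: "homogeneous 0 1"
  by (simp add: homogeneous_def monom_weight_def)

lemma homogeneous_single: "c \<noteq> 0 \<longrightarrow> monom_weight t = w \<Longrightarrow> homogeneous w (Poly_Mapping.single t c)"
  by (auto simp: homogeneous_def)

lemma homogeneous_Var: "homogeneous (var_weight v) (Var v)"
  by (simp add: Var_def homogeneous_single)

lemma homogeneous_add: "homogeneous w p \<Longrightarrow> homogeneous w q \<Longrightarrow> homogeneous w (p + q)"
  using Poly_Mapping.keys_add[of p q] by (fastforce simp: homogeneous_def)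

lemma homogeneous_diff: "homogeneous w p \<Longrightarrow> homogeneous w q \<Longrightarrow> homogeneous w (p - q)"
  using Poly_Mapping.keys_diff[of p q] by (fastforce simp: homogeneous_def)

lemma homogeneous_sum: "(\<And>x. x \<in> A \<Longrightarrow> homogeneous w (f x)) \<Longrightarrow> homogeneous w (sum f A)"
  by (induction A rule: infinite_finite_induct) (auto simp: homogeneous_add)

lemma homogeneous_mult:
  assumes "homogeneous v p" "homogeneous w q"
  shows "homogeneous (v + w) (p * q)"
  unfolding homogeneous_def
proof
  fix t assume "t \<in> Poly_Mapping.keys (p * q)"
  then obtain a b where "t = a + b" "a \<in> Poly_Mapping.keys p" "b \<in> Poly_Mapping.keys q"
    using keys_mult[of p q] by blast
  then show "monom_weight t = v + w"
    using assms by (simp add: homogeneous_def monom_weight_add)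
qed

lemma homogeneous_of_nat_mult: "homogeneous w p \<Longrightarrow> homogeneous w (of_nat k * p)"
  by (induction k) (simp_all add: distrib_right homogeneous_add)

lemma var_weight_next_var [simp]: "var_weight (next_var v) = Suc (var_weight v)"
  by (cases v) simp_all

text \<open>Each summand of the derivative trades one factor v of a monomial for its derivative,
  whose weight is one higher.\<close>

lemma homogeneous_dd:
  assumes "homogeneous w p"
  shows "homogeneous (Suc w) (dd p)"
  unfolding dd_def deriv_monom_def
proof (intro homogeneous_sum)
  fix t v assume t: "t \<in> Poly_Mapping.keys p" and v: "v \<in> Poly_Mapping.keys t"
  let ?s = "t - Poly_Mapping.single v 1"
  \<comment> \<open>Truncated subtraction is exact here because v occurs in t.\<close>
  have "t = ?s + Poly_Mapping.single v 1"
    using v by (intro poly_mapping_eqI)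
      (auto simp: lookup_add lookup_minus lookup_single when_def in_keys_iff)
  then have "monom_weight t = monom_weight ?s + var_weight v"
    using monom_weight_add[of ?s "Poly_Mapping.single v 1"] by simp
  then have w: "Suc w = monom_weight ?s + var_weight (next_var v)"
    using t assms by (simp add: homogeneous_def)
  show "homogeneous (Suc w) (Poly_Mapping.single ?s
      (of_nat (Poly_Mapping.lookup t v) * Poly_Mapping.lookup p t) * Var (next_var v))"
    unfolding w by (intro homogeneous_mult homogeneous_Var homogeneous_single) simp
qed

lemma homogeneous_dd_pow: "homogeneous w p \<Longrightarrow> homogeneous (w + r) ((dd ^^ r) p)"
  by (induction r) (simp_all add: homogeneous_dd)

section \<open>Closure properties of \<open>ring_RY n j\<close>\<close>

lemma zero_in_ring_RY [simp]: "0 \<in> ring_RY n j"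
  by (simp add: ring_RY_def)

lemma one_in_ring_RY: "1 \<in> ring_RY n j"
  by (simp add: ring_RY_def)

lemma diff_in_ring_RY: "p \<in> ring_RY n j \<Longrightarrow> q \<in> ring_RY n j \<Longrightarrow> p - q \<in> ring_RY n j"
  using Poly_Mapping.keys_diff[of p q] by (fastforce simp: ring_RY_def)

lemma of_nat_mult_in_ring_RY: "p \<in> ring_RY n j \<Longrightarrow> of_nat k * p \<in> ring_RY n j"
  by (induction k) (simp_all add: distrib_right add_in_ring_RY)

lemma dd_pow_in_ring_RY: "p \<in> ring_RY n j \<Longrightarrow> (dd ^^ r) p \<in> ring_RY n j"
  by (induction r) (simp_all add: dd_in_ring_RY)

section \<open>The summands of the commutator coefficient\<close>

text \<open>The a_p or b_q of the overview, according to the family of variables \<open>x\<close>.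
  The values 1 and 0 at indices 0 and 1 make each operator a single sum whose coefficient of index p
  has weight p.\<close>

definition op_coeff :: "(nat \<Rightarrow> dvar) \<Rightarrow> nat \<Rightarrow> 'a::comm_ring_1 dpoly" where
  "op_coeff x p = (if p = 0 then 1 else if p = 1 then 0 else Var (x p))"

lemma homogeneous_op_coeff:
  assumes "\<And>p. var_weight (x p) = p"
  shows "homogeneous p (op_coeff x p :: 'a::comm_ring_1 dpoly)"
  using homogeneous_Var[of "x p", where 'a = 'a] assms
  by (simp add: op_coeff_def homogeneous_1)

lemma op_coeff_in_ring_RY:
  "(p \<ge> 2 \<Longrightarrow> x p \<in> vars_RY n j) \<Longrightarrow> op_coeff x p \<in> ring_RY n j"
  by (simp add: op_coeff_def one_in_ring_RY Var_in_ring_RY)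

lemma monic_op_as_sum:
  assumes "k \<ge> 2"
  shows "monom 1 k + (\<Sum>l=2..k. monom (Var (x l)) (k - l)) =
    (\<Sum>p\<le>k. monom (op_coeff x p :: 'a::comm_ring_1 dpoly) (k - p))"
proof -
  have "{..k} = {0, 1} \<union> {2..k}"
    using assms by auto
  then have "(\<Sum>p\<le>k. monom (op_coeff x p :: 'a dpoly) (k - p))
      = (\<Sum>p\<in>{0, 1}. monom (op_coeff x p) (k - p)) + (\<Sum>p=2..k. monom (op_coeff x p) (k - p))"
    by (simp only:) (rule sum.union_disjoint, auto)
  then show ?thesis
    by (simp add: op_coeff_def)
qed

text \<open>The contribution of a_p and b_q to the coefficient of D^(m+n-i) in [L,P], with r = i - p
  - q; the pairs with r = 0 have cancelled.\<close>

definition bracket_term :: "nat \<Rightarrow> nat \<Rightarrow> nat \<Rightarrow> nat \<Rightarrow> nat \<Rightarrow> 'a::comm_ring_1 dpoly" where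
  "bracket_term n m i p q =
     (if p + q < i
      then of_nat ((n - p) choose (i - p - q)) * op_coeff (\<lambda>l. UVar l 0) p
             * (dd ^^ (i - p - q)) (op_coeff (\<lambda>l. YVar l 0) q)
         - of_nat ((m - q) choose (i - p - q)) * op_coeff (\<lambda>l. YVar l 0) q
             * (dd ^^ (i - p - q)) (op_coeff (\<lambda>l. UVar l 0) p)
      else 0)"

lemma E_coeff_eq_sum:
  assumes "n \<ge> 2" "m \<ge> 2" "i \<le> m + n"
  shows "(E_coeff n m (m + n - i) :: 'a::comm_ring_1 dpoly) = (\<Sum>q\<le>m. \<Sum>p\<le>n. bracket_term n m i p q)"
proof -
  interpret derivation "dd :: 'a dpoly \<Rightarrow> _" by (rule derivation_dd)
  show ?thesis
    unfolding E_coeff_def L_op_def P_op_def bracket_term_def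
      monic_op_as_sum[OF assms(1), of "\<lambda>l. UVar l 0"] monic_op_as_sum[OF assms(2), of "\<lambda>l. YVar l 0"]
    by (rule coeff_op_bracket_sum_monom[OF assms(3)])
qed

text \<open>Both products have weight p + q + r = i, since r derivations add r to the
  weight.\<close>

lemma homogeneous_bracket_term: "homogeneous i (bracket_term n m i p q :: 'a::comm_ring_1 dpoly)"
proof (cases "p + q < i")
  case True
  let ?a = "op_coeff (\<lambda>l. UVar l 0) p :: 'a dpoly" and ?b = "op_coeff (\<lambda>l. YVar l 0) q :: 'a dpoly"
    and ?r = "i - p - q"
  have "homogeneous p ?a" "homogeneous q ?b"
    by (simp_all add: homogeneous_op_coeff)
  then have "homogeneous (p + (q + ?r)) (?a * (dd ^^ ?r) ?b)"
    "homogeneous (q + (p + ?r)) (?b * (dd ^^ ?r) ?a)"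
    by (intro homogeneous_mult homogeneous_dd_pow; simp)+
  moreover have "p + (q + ?r) = i" "q + (p + ?r) = i"
    using True by auto
  ultimately show ?thesis
    using True
    by (simp add: bracket_term_def mult.assoc homogeneous_diff homogeneous_of_nat_mult)
qed (simp add: bracket_term_def)

lemma bracket_term_in_ring_RY:
  assumes "p \<le> n" "q \<le> j"
  shows "(bracket_term n m i p q :: 'a::comm_ring_1 dpoly) \<in> ring_RY n j"
proof -
  have "(op_coeff (\<lambda>l. UVar l 0) p :: 'a dpoly) \<in> ring_RY n j"
    "(op_coeff (\<lambda>l. YVar l 0) q :: 'a dpoly) \<in> ring_RY n j"
    using assms by (auto intro!: op_coeff_in_ring_RY simp: vars_RY_def)
  then show ?thesis
    by (simp add: bracket_term_def mult.assoc diff_in_ring_RY of_nat_mult_in_ring_RY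
        mult_in_ring_RY dd_pow_in_ring_RY)
qed

section \<open>Isolating the leading term, and the case i = 3\<close>

lemma E_coeff_split:
  assumes "n \<ge> 2" "m \<ge> 2" "i \<in> {3..m + 1}"
  shows "(E_coeff n m (m + n - i) :: 'a::comm_ring_1 dpoly) =
    of_nat n * dd (yvar (i - 1)) + (\<Sum>q\<le>i - 2. \<Sum>p\<le>n. bracket_term n m i p q)"
proof -
  interpret derivation "dd :: 'a dpoly \<Rightarrow> _" by (rule derivation_dd)
  let ?T = "bracket_term n m i :: _ \<Rightarrow> _ \<Rightarrow> 'a dpoly"
  have Suc: "Suc (i - 2) = i - 1"
    using assms by auto
  have "E_coeff n m (m + n - i) = (\<Sum>q\<le>m. \<Sum>p\<le>n. ?T p q)"
    using assms by (intro E_coeff_eq_sum) auto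
  \<comment> \<open>For q \<ge> i no p satisfies p + q < i. The bound i \<le> m + 1 keeps i - 1
    within the range of q.\<close>
  also have "\<dots> = (\<Sum>q\<le>Suc (i - 2). \<Sum>p\<le>n. ?T p q)"
    using assms by (intro sum.mono_neutral_right ballI sum.neutral) (auto simp: bracket_term_def)
  also have "\<dots> = (\<Sum>p\<le>n. ?T p (i - 1)) + (\<Sum>q\<le>i - 2. \<Sum>p\<le>n. ?T p q)"
    unfolding sum.atMost_Suc unfolding Suc by (rule add.commute)
  \<comment> \<open>With q = i - 1, the condition p + q < i forces p = 0 and r = 1.\<close>
  also have "(\<Sum>p\<le>n. ?T p (i - 1)) = (\<Sum>p\<in>{0}. ?T p (i - 1))"
    using assms by (intro sum.mono_neutral_right) (auto simp: bracket_term_def)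
  \<comment> \<open>Here a_0 = 1, so the second product contains the derivative of 1 and vanishes.
    As i - 1 \<ge> 2, b_(i-1) is a genuine variable.\<close>
  also have "\<dots> = of_nat n * dd (yvar (i - 1))"
    using assms by (auto simp: bracket_term_def op_coeff_def simp del: dd_Var)
  finally show ?thesis .
qed

lemma E_coeff_3:
  assumes "n \<ge> 2" "m \<ge> 2"
  shows "(E_coeff n m (m + n - 3) :: 'a::comm_ring_1 dpoly) = of_nat n * dd (yvar 2) - of_nat m * dd (uvar 2)"
proof -
  interpret derivation "dd :: 'a dpoly \<Rightarrow> _" by (rule derivation_dd)
  let ?T = "bracket_term n m 3 :: _ \<Rightarrow> _ \<Rightarrow> 'a dpoly"
  \<comment> \<open>Every summand contains b_1 = 0 or a derivative of it.\<close>
  have "(\<Sum>p\<le>n. ?T p 1) = 0"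
    by (intro sum.neutral) (auto simp: bracket_term_def op_coeff_def)
  \<comment> \<open>Since b_0 = 1, only derivatives of a_p survive; these vanish for a_0 = 1 and a_1
    = 0, and p < 3 leaves p = 2 with r = 1.\<close>
  moreover have "(\<Sum>p\<le>n. ?T p 0) = (\<Sum>p\<in>{2}. ?T p 0)"
    using assms
    by (intro sum.mono_neutral_right) (auto simp: bracket_term_def op_coeff_def d_pow_1)
  moreover have "?T 2 0 = - (of_nat m * dd (uvar 2))"
    by (simp add: bracket_term_def op_coeff_def d_1)
  ultimately show ?thesis
    using E_coeff_split[of n m 3, where 'a = 'a] assms by simp
qed

theorem theorem4p6:
  fixes n m :: nat
  assumes "n \<ge> 2" and "m \<ge> 2"
  shows "(\<forall>i\<in>{3..m+1}. \<exists>e \<in> ring_RY n (i - 2). homogeneous i e \<and>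
            (E_coeff n m (m + n - i) :: 'a::field_char_0 dpoly) = of_nat n * dd (yvar (i - 1)) + e)
       \<and> (E_coeff n m (m + n - 3) :: 'a dpoly) = of_nat n * dd (yvar 2) - of_nat m * dd (uvar 2)"
proof (intro conjI ballI)
  fix i assume "i \<in> {3..m+1}"
  then show "\<exists>e \<in> ring_RY n (i - 2). homogeneous i e \<and>
      (E_coeff n m (m + n - i) :: 'a dpoly) = of_nat n * dd (yvar (i - 1)) + e"
    using assms
    \<comment> \<open>The witness is the remainder of \<open>E_coeff_split\<close>; its range q
      \<le> i - 2 gives membership in \<open>ring_RY n (i - 2)\<close>.\<close>
    by (intro bexI[of _ "\<Sum>q\<le>i - 2. \<Sum>p\<le>n. bracket_term n m i p q"] conjI E_coeff_split
        homogeneous_sum homogeneous_bracket_term sum_in_ring_RY bracket_term_in_ring_RY) auto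
qed (rule E_coeff_3[OF assms])

end
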